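(* For every integer $m\ge 2$ such that $m$ is odd or $m\equiv 2\pmod 4$, there is no $(m,3)$-generalized bent function.
   Context: For integers $m\ge 2$ and $n\ge 1$, put $\zeta_m=e^{2\pi\sqrt{-1}/m}$. A function $f:\mathbb{Z}_2^n\to\mathbb{Z}_m$ (where $\mathbb{Z}_m=\mathbb{Z}/m\mathbb{Z}$) is called an $(m,n)$-generalized bent function ($(m,n)$-GBF) if $|F(y)|^2=2^n$ for all $y\in\mathbb{Z}_2^n$, where $F(y)=\sum_{x\in\mathbb{Z}_2^n}\zeta_m^{f(x)}(-1)^{y\cdot x}$ and $y\cdot x$ is the usual inner product. *)

theory Defs
  imports Complex_Main "HOL-Library.FuncSet" "HOL-Number_Theory.Residues"
begin

text \<open>
  The residue class ring of the integers modulo \<open>m\<close> is the library's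
  \<^term>\<open>residue_ring m\<close>, whose elements are the representatives \<open>0, ..., m - 1\<close>.
  Vectors of length \<open>n\<close> over the integers modulo 2 are functions on \<open>{..<n}\<close>
  that are \<^const>\<open>undefined\<close> elsewhere, so there are exactly \<open>2 ^ n\<close> of them.
\<close>

definition Z2_vectors :: "nat \<Rightarrow> (nat \<Rightarrow> int) set" where
  "Z2_vectors n = {..<n} \<rightarrow>\<^sub>E carrier (residue_ring 2)"

definition inner_Z2 :: "nat \<Rightarrow> (nat \<Rightarrow> int) \<Rightarrow> (nat \<Rightarrow> int) \<Rightarrow> int" where
  "inner_Z2 n y x = (\<Sum>i<n. y i * x i) mod 2"

definition zeta :: "int \<Rightarrow> complex" where
  "zeta m = exp (2 * of_real pi * \<i> / of_int m)"

definition gbf_transform ::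
  "int \<Rightarrow> nat \<Rightarrow> ((nat \<Rightarrow> int) \<Rightarrow> int) \<Rightarrow> (nat \<Rightarrow> int) \<Rightarrow> complex" where
  "gbf_transform m n f y =
     (\<Sum>x\<in>Z2_vectors n. zeta m powi f x * (- 1) powi inner_Z2 n y x)"

definition generalized_bent ::
  "int \<Rightarrow> nat \<Rightarrow> ((nat \<Rightarrow> int) \<Rightarrow> int) \<Rightarrow> bool" where
  "generalized_bent m n f \<longleftrightarrow>
     f \<in> Z2_vectors n \<rightarrow> carrier (residue_ring m) \<and>
     (\<forall>y\<in>Z2_vectors n. (cmod (gbf_transform m n f y))\<^sup>2 = 2 ^ n)"

end

(*
  The values of the generalized bent function are a(x) = e(x) w(x) with a sign e(x) and w(x)
  a root of unity of odd order, and flatness of the spectrum says that the autocorrelation of a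
  vanishes in each of the seven nonzero directions s.  Each such equation is a signed sum of four
  traces t = r + 1/r with r = w(x) / w(x + s).  As r has odd order, r -> r^2 extends to a field
  automorphism, so the same signed sum vanishes for r^2, r^4 and r^8, that is, for the iterates of
  t -> t^2 - 2.  These four power sum equations pin down the traces: with equal signs the t are
  2, -1 and the two roots of t^2 + t - 1; with one deviating sign the odd-one-out has order 3 or 5;
  with balanced signs the traces agree in pairs.  Up to a character, the sign pattern e on F_2^3 is
  constant, a point, or a quadric with a one-dimensional radical, and each is incompatible with
  these local solutions.
*)

theory Submission
  imports Defs "HOL-Computational_Algebra.Polynomial_Factorial" "HOL-Library.Z2"
    "HOL-Library.Product_Plus"
begin

section \<open>Squaring roots of unity of odd order\<close>

text \<open>The target ring is left open because two are needed: the complex numbers, to evaluate at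
  roots of unity, and \<open>bit\<close>, to reduce modulo 2.\<close>

abbreviation ipoly :: "int poly \<Rightarrow> 'a::comm_ring_1 poly" where
  "ipoly \<equiv> map_poly of_int"

lemma ipoly_add: "ipoly (p + q) = (ipoly p + ipoly q :: 'a::comm_ring_1 poly)"
  by (rule poly_eqI) (simp add: coeff_map_poly)

lemma ipoly_diff: "ipoly (p - q) = (ipoly p - ipoly q :: 'a::comm_ring_1 poly)"
  by (rule poly_eqI) (simp add: coeff_map_poly)

lemma ipoly_mult: "ipoly (p * q) = (ipoly p * ipoly q :: 'a::comm_ring_1 poly)"
  by (rule poly_eqI) (simp add: coeff_map_poly coeff_mult)

lemma ipoly_smult: "ipoly (smult c q) = (smult (of_int c) (ipoly q) :: 'a::comm_ring_1 poly)"
  by (rule poly_eqI) (simp add: coeff_map_poly)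

lemma ipoly_monom: "ipoly (monom c n) = (monom (of_int c) n :: 'a::comm_ring_1 poly)"
  by (rule poly_eqI) (simp add: coeff_map_poly)

lemma ipoly_sum: "ipoly (sum f A) = (\<Sum>x\<in>A. ipoly (f x) :: 'a::comm_ring_1 poly)"
  by (induction A rule: infinite_finite_induct) (simp_all add: ipoly_add)

lemma ipoly_numeral: "ipoly (numeral k) = (numeral k :: 'a::comm_ring_1 poly)"
  by (simp add: numeral_poly map_poly_pCons)

lemma poly_ipoly_pcompose_square:
  fixes z :: "'a::comm_ring_1"
  shows "poly (ipoly (f \<circ>\<^sub>p monom 1 2)) z = poly (ipoly f) (z ^ 2)"
  by (induction f)
    (simp_all add: pcompose_pCons ipoly_add ipoly_mult ipoly_monom poly_monom map_poly_pCons)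

text \<open>Modulo 2 squaring is additive and fixes every coefficient; the induction splits off the
  constant term, whose cross term in the square is even.\<close>

lemma two_dvd_pcompose_square_diff:
  "2 dvd (f \<circ>\<^sub>p monom 1 2 - f ^ 2 :: int poly)"
proof (induction f)
  case (pCons a g)
  have eq: "pCons a g = [:a:] + monom 1 1 * g"
    by (simp add: monom_altdef)
  have sq: "(monom 1 2 :: int poly) = monom 1 1 * monom 1 1"
    by (simp add: mult_monom numeral_2_eq_2)
  have "even (a - a * a)" by simp
  then obtain b where "a - a * a = 2 * b" by blast
  then have ab: "[:a:] - [:a:] * [:a:] = 2 * [:b:]"
    by (simp add: numeral_poly)
  have "pCons a g \<circ>\<^sub>p monom 1 2 - pCons a g ^ 2
      = ([:a:] - [:a:] * [:a:]) - 2 * ([:a:] * monom 1 1 * g)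
        + monom 1 2 * (g \<circ>\<^sub>p monom 1 2 - g ^ 2)"
    unfolding pcompose_pCons unfolding eq sq
    by (simp add: algebra_simps power2_eq_square)
  then show ?case
    unfolding ab using pCons.IH by (metis dvd_add dvd_diff dvd_mult dvd_triv_left)
qed simp

text \<open>Gauss's lemma for the primitive part of an annihilator of least degree: pseudo-division
  gives \<open>smult c P = f * q\<close>, and as \<open>f\<close> has content 1, \<open>c\<close>
  divides the content of \<open>q\<close> and cancels.\<close>

lemma primitive_annihilator:
  fixes z :: complex
  assumes "p \<noteq> 0" "poly (ipoly p) z = 0"
  obtains f :: "int poly" where "poly (ipoly f) z = 0"
    "\<And>P. poly (ipoly P) z = 0 \<Longrightarrow> f dvd P"
proof -
  define Q where "Q q \<longleftrightarrow> q \<noteq> 0 \<and> poly (ipoly q) z = 0" for q :: "int poly"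
  obtain g where g: "Q g" and min: "\<And>q. Q q \<Longrightarrow> degree g \<le> degree q"
    using ex_has_least_nat[of Q p degree] assms unfolding Q_def by blast
  define f where "f = primitive_part g"
  have g0: "g \<noteq> 0" "poly (ipoly g) z = 0" using g by (auto simp: Q_def)
  have geq: "g = smult (content g) f" by (simp add: f_def)
  have cg: "content g \<noteq> 0" using g0 by simp
  have fz: "poly (ipoly f) z = 0"
    using g0 cg by (subst (asm) (2) geq) (simp add: ipoly_smult)
  have f0: "f \<noteq> 0" using g0 by (simp add: f_def)
  have cf: "content f = 1" using g0 by (simp add: f_def)
  have df: "degree f = degree g" using g0 by (simp add: f_def)
  have "f dvd P" if P: "poly (ipoly P) z = 0" for P
  proof -
    obtain q r where qr: "pseudo_divmod P f = (q, r)" by fastforce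
    define c where "c = coeff f (degree f) ^ (Suc (degree P) - degree f)"
    have e: "smult c P = f * q + r" and d: "r = 0 \<or> degree r < degree f"
      using pseudo_divmod[OF f0 qr] by (auto simp: c_def)
    have c0: "c \<noteq> 0" using f0 by (simp add: c_def)
    have "poly (ipoly (smult c P)) z = poly (ipoly r) z"
      unfolding e by (simp add: ipoly_add ipoly_mult fz)
    then have "poly (ipoly r) z = 0" using P by (simp add: ipoly_smult)
    then have "r = 0" using d min[of r] df by (metis Q_def linorder_not_less)
    then have e: "smult c P = f * q" using e by simp
    then have "content (smult c P) = content q" using cf by (simp add: content_mult)
    then have "c dvd content q" by (metis content_smult dvd_triv_left normalize_dvd_iff)
    then have "[:c:] dvd q" by (simp add: const_poly_dvd_iff_dvd_content)
    then obtain q' where "q = [:c:] * q'" by blast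
    then have "[:c:] * P = [:c:] * (f * q')" using e by simp
    then have "P = f * q'" using c0 by (subst (asm) mult_left_cancel) simp_all
    then show ?thesis by simp
  qed
  with fz show ?thesis by (rule that)
qed

text \<open>
  If the primitive annihilator \<open>f\<close> of \<open>z\<close>, a divisor of \<open>X ^ k - 1\<close>, did not vanish at \<open>z\<^sup>2\<close>, then
  the derivative of \<open>X ^ k - 1\<close> at \<open>z\<^sup>2\<close> would be a multiple of \<open>f (z\<^sup>2)\<close>, which is divisible by 2
  since \<open>f (X\<^sup>2)\<close> and \<open>f\<^sup>2\<close> agree modulo 2. So \<open>k\<close> would be even in \<open>\<int>[z]\<close>, and \<open>f\<close> a unit modulo 2.
\<close>
lemma root_of_unity_Frobenius:
  fixes z :: complex
  assumes k: "odd k" and z: "z ^ k = 1" and P: "poly (ipoly P) z = 0"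
  shows "poly (ipoly P) (z ^ 2) = 0"
proof -
  have k0: "k > 0" using k by (cases k) auto
  define X :: "int poly" where "X = monom 1 k - 1"
  have Xev: "poly (ipoly X) y = y ^ k - 1" for y :: complex
    by (simp add: X_def ipoly_diff ipoly_monom poly_monom)
  have lX: "lead_coeff X = 1"
    using lead_coeff_add_le[of "-1 :: int poly" "monom 1 k"] k0
    by (simp add: X_def degree_monom_eq del: add_uminus_conv_diff)
  have X0: "X \<noteq> 0" using lX by auto
  obtain f where fz: "poly (ipoly f) z = 0" and fd: "\<And>P. poly (ipoly P) z = 0 \<Longrightarrow> f dvd P"
    using primitive_annihilator[OF X0, of z] Xev z by auto
  have "f dvd X" using fd Xev z by simp
  then obtain h where h: "X = f * h" by blast
  have "poly (ipoly f) (z ^ 2) = 0"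
  proof (rule ccontr)
    assume nz: "poly (ipoly f) (z ^ 2) \<noteq> 0"
    obtain g where "f \<circ>\<^sub>p monom 1 2 - f ^ 2 = 2 * g"
      using two_dvd_pcompose_square_diff by blast
    then have "f \<circ>\<^sub>p monom 1 2 = f * f + 2 * g" by (simp add: power2_eq_square algebra_simps)
    then have f2: "poly (ipoly f) (z ^ 2) = 2 * poly (ipoly g) z"
      using fz by (simp add: poly_ipoly_pcompose_square[symmetric] ipoly_add ipoly_mult
          ipoly_numeral)
    have "(z ^ 2) ^ k = 1" using z by (metis power_mult mult.commute power_one)
    then have hz: "poly (ipoly h) (z ^ 2) = 0"
      using Xev[of "z ^ 2"] nz by (simp add: h ipoly_mult)
    have "pderiv X = monom (of_nat k) (k - 1)"
      by (simp add: X_def pderiv_diff pderiv_monom)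
    then have "poly (ipoly (pderiv X)) (z ^ 2) = of_nat k * (z ^ 2) ^ (k - 1)"
      by (simp add: ipoly_monom poly_monom)
    moreover have "poly (ipoly (pderiv X)) (z ^ 2)
        = poly (ipoly f) (z ^ 2) * poly (ipoly (pderiv h)) (z ^ 2)"
      by (simp add: h pderiv_mult ipoly_add ipoly_mult hz)
    ultimately have "of_nat k * (z ^ 2) ^ (k - 1)
        = 2 * poly (ipoly g) z * poly (ipoly (pderiv h)) (z ^ 2)"
      using f2 by simp
    \<comment> \<open>Multiplying by \<open>z ^ 2\<close> completes the power to
      \<open>(z ^ 2) ^ k = 1\<close>, which isolates \<open>k\<close>.\<close>
    then have "of_nat k * (z ^ 2) ^ k = 2 * poly (ipoly g) z * poly (ipoly (pderiv h)) (z ^ 2) *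
        z ^ 2"
      using k0 by (metis (no_types, lifting) Suc_diff_1 mult.assoc power_Suc2)
    then have kz: "of_nat k = 2 * poly (ipoly g) z * poly (ipoly (pderiv h)) (z ^ 2) * z ^ 2"
      using \<open>(z ^ 2) ^ k = 1\<close> by simp
    \<comment> \<open>\<open>R\<close> turns this identity into an integer polynomial vanishing at
      \<open>z\<close>; modulo 2 it is the constant 1, because \<open>k\<close> is odd.\<close>
    define R where "R = monom (int k) 0 - 2 * (g * (pderiv h \<circ>\<^sub>p monom 1 2) * monom 1 2)"
    have "poly (ipoly R) z = 0"
      using kz by (simp add: R_def ipoly_diff ipoly_mult ipoly_monom poly_monom
          poly_ipoly_pcompose_square ipoly_numeral)
    then have "f dvd R" by (rule fd)
    then obtain r where r: "R = f * r" by blast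
    have two: "(2 :: bit poly) = 0" by (simp add: numeral_poly)
    have "ipoly R = (1 :: bit poly)"
      unfolding R_def ipoly_diff ipoly_mult ipoly_numeral two ipoly_monom
      using k by (auto elim!: oddE simp: monom_0 one_pCons)
    then have "ipoly f * ipoly r = (1 :: bit poly)" by (simp add: r ipoly_mult)
    then have "is_unit (ipoly f :: bit poly)" by (metis dvd_triv_left)
    then have "degree (ipoly f :: bit poly) = 0"
      by (simp add: is_unit_poly_iff)
        (metis degree_pCons_0)
    \<comment> \<open>\<open>X\<close> is monic, so the leading coefficient of \<open>f\<close> is
      odd and reduction modulo 2 preserves the degree; hence \<open>f\<close>, a unit modulo 2, is
      constant.\<close>
    moreover have "lead_coeff f * lead_coeff h = 1" using lX by (simp add: h lead_coeff_mult)
    then have "odd (lead_coeff f)" by (metis dvd_mult2 odd_one)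
    then have "of_int (lead_coeff f) \<noteq> (0 :: bit)" by (auto elim!: oddE)
    then have "degree f \<le> degree (ipoly f :: bit poly)"
      by (intro le_degree) (simp add: coeff_map_poly)
    ultimately have "degree f = 0" by simp
    then obtain a where "f = [:a:]" by (meson degree_eq_zeroE)
    then show False using fz \<open>odd (lead_coeff f)\<close> by (auto simp: map_poly_pCons)
  qed
  moreover obtain q where "P = f * q" using fd[OF P] by blast
  ultimately show ?thesis by (simp add: ipoly_mult)
qed

text \<open>All \<open>w x\<close> are powers of one root of unity \<open>z\<close>, so the relation
  is an integer polynomial vanishing at \<open>z\<close>, and it passes to
  \<open>z ^ 2\<close>.\<close>

lemma roots_of_unity_sum_square:
  fixes w :: "'a \<Rightarrow> complex" and c :: "'a \<Rightarrow> int"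
  assumes "odd k" and w: "\<And>x. x \<in> A \<Longrightarrow> w x ^ k = 1"
    and s: "(\<Sum>x\<in>A. of_int (c x) * w x) = 0"
  shows "(\<Sum>x\<in>A. of_int (c x) * w x ^ 2) = 0"
proof -
  have k0: "k > 0" using \<open>odd k\<close> by (cases k) auto
  define z where "z = cis (2 * pi / real k)"
  have zk: "z ^ k = 1" using k0 by (simp add: z_def DeMoivre)
  have "\<exists>j. w x = z ^ j" if "x \<in> A" for x
  proof -
    have "w x \<in> (\<lambda>j. cis (2 * pi * real j / real k)) ` {..<k}"
      using bij_betw_roots_unity[OF k0] w[OF that] by (auto simp: bij_betw_def)
    then show ?thesis by (auto simp: z_def DeMoivre mult_ac)
  qed
  then obtain j where j: "\<And>x. x \<in> A \<Longrightarrow> w x = z ^ j x" by metis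
  define P where "P = (\<Sum>x\<in>A. monom (c x) (j x))"
  have ev: "poly (ipoly P) y = (\<Sum>x\<in>A. of_int (c x) * y ^ j x)" for y :: complex
    by (simp add: P_def ipoly_sum poly_sum ipoly_monom poly_monom)
  have "poly (ipoly P) (z ^ 2) = 0"
    by (rule root_of_unity_Frobenius[OF \<open>odd k\<close> zk]) (use s j in \<open>simp add: ev\<close>)
  then show ?thesis using j by (simp add: ev power_mult[symmetric] mult.commute)
qed

section \<open>Sign patterns on the cube\<close>

type_synonym cube = "bit \<times> bit \<times> bit"

lemma bit_double [simp]: "b + b = (0 :: bit)"
  by (cases b) simp_all

lemma bit_double_left [simp]: "b + (b + c) = (c :: bit)"
  by (cases b) simp_all

lemma cube_double [simp]: "x + x = (0 :: cube)"
  by (cases x) (simp add: zero_prod_def)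

lemma cube_double_left [simp]: "x + (x + y) = (y :: cube)"
  by (metis add.assoc add_0 cube_double)

lemma cube_sum_eq_iff: "x + s = u \<longleftrightarrow> x = u + (s :: cube)"
  by (metis add.commute cube_double_left)

text \<open>Algebraic normal form over F_2: by Moebius inversion, the coefficient of a monomial is
  the sum of \<open>n\<close> over the points supported on its variables.\<close>

lemma cube_polynomial:
  fixes n :: "cube \<Rightarrow> bit"
  obtains c p q r a b g h where
    "\<And>x y z. n (x, y, z) = c + p * x + q * y + r * z + a * (y * z) + b * (x * z) + g * (x * y)
        + h * (x * y * z)"
proof
  show "n (x, y, z) = n (0,0,0) + (n (0,0,0) + n (1,0,0)) * x + (n (0,0,0) + n (0,1,0)) * y
    + (n (0,0,0) + n (0,0,1)) * z
    + (n (0,0,0) + n (0,1,0) + n (0,0,1) + n (0,1,1)) * (y * z)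
    + (n (0,0,0) + n (1,0,0) + n (0,0,1) + n (1,0,1)) * (x * z)
    + (n (0,0,0) + n (1,0,0) + n (0,1,0) + n (1,1,0)) * (x * y)
    + (n (0,0,0) + n (1,0,0) + n (0,1,0) + n (0,0,1)
      + n (0,1,1) + n (1,0,1) + n (1,1,0) + n (1,1,1)) * (x * y * z)" for x y z
    by (cases x; cases y; cases z) (simp_all add: ac_simps del: add_bit_eq_xor mult_bit_eq_and)
qed

text \<open>The left side is the determinant of \<open>d\<close>, \<open>s\<close>, \<open>v\<close>
  over F_2, and the hypotheses make these vectors linearly independent.\<close>

lemma cube_triple_product:
  fixes d1 d2 d3 s1 s2 s3 v1 v2 v3 :: bit
  assumes d: "(d1,d2,d3) \<noteq> 0"
   and s: "(s1,s2,s3) \<noteq> 0" "(s1,s2,s3) \<noteq> (d1,d2,d3)"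
   and v: "(v1,v2,v3) \<noteq> 0" "(v1,v2,v3) \<noteq> (s1,s2,s3)" "(v1,v2,v3) \<noteq> (d1,d2,d3)"
   "(v1,v2,v3) \<noteq> (s1,s2,s3) + (d1,d2,d3)"
  shows "d1 * (s2 * v3 + s3 * v2) + d2 * (s1 * v3 + s3 * v1) + d3 * (s1 * v2 + s2 * v1) = 1"
  using assms
  apply (cases d1; cases d2; cases d3; cases s1; cases s2; cases s3; simp add: zero_prod_def)
  apply (cases v1; cases v2; cases v3; simp)+
  done

text \<open>
  The cases are: a cubic, which is an affine function plus the indicator of a point; a nonzero
  quadratic form, whose polar form has the radical spanned by \<open>d\<close>; and an affine function.
\<close>
lemma cube_trichotomy:
  fixes n :: "cube \<Rightarrow> bit"
  obtains
    (point) u where "\<And>s x. s \<noteq> 0 \<Longrightarrow> x \<noteq> u \<Longrightarrow> x \<noteq> u + s \<Longrightarrow> n x + n (x + s) = n u + n (u + s) + 1"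
  | (line) d where "d \<noteq> 0" "\<And>x. n x + n (x + d) = n 0 + n d"
      "\<And>s x y. s \<noteq> 0 \<Longrightarrow> s \<noteq> d \<Longrightarrow> x + y \<notin> {0, s, d, s + d} \<Longrightarrow> n x + n (x + s) = n y + n (y + s) + 1"
  | (affine) "\<And>s x. n x + n (x + s) = n 0 + n s"
proof -
  note [simp del] = add_bit_eq_xor mult_bit_eq_and
  obtain c p q r a b g h where
    n: "\<And>x y z. n (x, y, z) = c + p * x + q * y + r * z + a * (y * z) + b * (x * z) + g * (x * y)
        + h * (x * y * z)"
    using cube_polynomial[of n] by blast
  show ?thesis
  proof (cases "h = 1")
    case True
    \<comment> \<open>The product \<open>(x + a) * (y + b) * (z + g)\<close> absorbs all terms of
      degree 2 and 3 and is 1 only at \<open>u\<close>; \<open>L\<close> collects the affine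
      remainder.\<close>
    define u where "u = (1 + a, 1 + b, 1 + g)"
    define L where "L = (\<lambda>(x, y, z). (c + a * b * g) + (p + b * g) * x + (q + a * g) * y + (r
        + a * b) * z)"
    have M: "(x + a) * (y + b) * (z + g) = of_bool ((x, y, z) = u)" for x y z
      by (cases x; cases y; cases z; cases a; cases b; cases g) (simp_all add: u_def)
    have nL: "n x = L x + of_bool (x = u)" for x
      by (cases x) (simp add: M[symmetric] n L_def True algebra_simps)
    have LL: "L x + L (x + s) = L y + L (y + s)" for x y s
      by (cases x; cases y; cases s) (simp add: L_def algebra_simps)
    show ?thesis
    proof (rule point)
      fix s x :: cube assume "s \<noteq> 0" "x \<noteq> u" "x \<noteq> u + s"
      then have "x + s \<noteq> u" "u + s \<noteq> u" by (simp_all add: cube_sum_eq_iff)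
      then show "n x + n (x + s) = n u + n (u + s) + 1"
        using LL[of x s u] \<open>x \<noteq> u\<close> by (simp add: nL)
    qed
  next
    case False
    then have h: "h = 0" by simp
    \<comment> \<open>The affine part drops out, leaving the determinant of
      \<open>(a, b, g)\<close>, \<open>s\<close> and \<open>x + y\<close>.\<close>
    have B: "n (x1,x2,x3) + n ((x1,x2,x3) + (s1,s2,s3)) + (n (y1,y2,y3) + n ((y1,y2,y3)
        + (s1,s2,s3)))
       = a * (s2 * (x3 + y3) + s3 * (x2 + y2)) + b * (s1 * (x3 + y3) + s3 * (x1 + y1))
           + g * (s1 * (x2 + y2) + s2 * (x1 + y1))"
      for x1 x2 x3 y1 y2 y3 s1 s2 s3
      by (simp add: n h algebra_simps)
    show ?thesis
    proof (cases "(a, b, g) = 0")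
      case True
      show ?thesis
        by (rule affine) (use True in \<open>auto simp: n h zero_prod_def algebra_simps\<close>)
    next
      case False
      show ?thesis
      proof (rule line[OF False])
        show "n x + n (x + (a, b, g)) = n 0 + n (a, b, g)" for x
          by (cases x) (simp add: n h algebra_simps zero_prod_def)
        fix s x y :: cube
        assume A: "s \<noteq> 0" "s \<noteq> (a, b, g)" "x + y \<notin> {0, s, (a, b, g), s + (a, b, g)}"
        obtain s1 s2 s3 x1 x2 x3 y1 y2 y3 where
          e: "s = (s1,s2,s3)" "x = (x1,x2,x3)" "y = (y1,y2,y3)" by (metis prod_cases3)
        have "n x + n (x + s) + (n y + n (y + s)) = 1"
          unfolding e B by (rule cube_triple_product[OF False]) (use A e in auto)
        then show "n x + n (x + s) = n y + n (y + s) + 1"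
          by (metis add.commute bit_double_left)
      qed
    qed
  qed
qed

section \<open>Power sums of traces\<close>

text \<open>Equal sums and equal sums of squares force equal products, so both pairs are the roots
  of one quadratic.\<close>

lemma two_power_sums_eq:
  fixes t1 :: complex
  assumes "t1 + t2 = t3 + t4" "t1\<^sup>2 + t2\<^sup>2 = t3\<^sup>2 + t4\<^sup>2"
  shows "t1 = t3 \<and> t2 = t4 \<or> t1 = t4 \<and> t2 = t3"
proof -
  have "(t1 - t3) * (t1 - t4) = 0" using assms by Groebner_Basis.algebra
  then show ?thesis using assms(1) by auto
qed

text \<open>The first two equations fix two coefficients of the quartic with these roots. Modulo
  this quartic the second iterate of t -> t^2 - 2 is affine in t, so the other two equations give
  \<open>g = 2\<close> and \<open>e\<^sup>2 = 1\<close>. For \<open>e = -1\<close> the quartic has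
  the root -2; for \<open>e = 1\<close> it is
  \<open>(t - 2) * (t + 1) * (t\<^sup>2 + t - 1)\<close>.\<close>

lemma four_traces:
  fixes t1 :: complex
  assumes 1: "t1 + t2 + t3 + t4 = 0"
    and 2: "(t1\<^sup>2 - 2) + (t2\<^sup>2 - 2) + (t3\<^sup>2 - 2) + (t4\<^sup>2 - 2) = 0"
    and 4: "((t1\<^sup>2 - 2)\<^sup>2 - 2) + ((t2\<^sup>2 - 2)\<^sup>2 - 2) + ((t3\<^sup>2 - 2)\<^sup>2 - 2) + ((t4\<^sup>2 - 2)\<^sup>2 - 2) = 0"
    and 8: "(((t1\<^sup>2 - 2)\<^sup>2 - 2)\<^sup>2 - 2) + (((t2\<^sup>2 - 2)\<^sup>2 - 2)\<^sup>2 - 2)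
      + (((t3\<^sup>2 - 2)\<^sup>2 - 2)\<^sup>2 - 2) + (((t4\<^sup>2 - 2)\<^sup>2 - 2)\<^sup>2 - 2) = 0"
    and n: "-2 \<notin> {t1, t2, t3, t4}"
  shows "2 \<in> {t1, t2, t3, t4} \<and> -1 \<in> {t1, t2, t3, t4} \<and>
     (\<forall>t\<in>{t1, t2, t3, t4}. t = 2 \<or> t = -1 \<or> t\<^sup>2 + t - 1 = 0)"
proof -
  define e where "e = t1 * t2 * t3 + t1 * t2 * t4 + t1 * t3 * t4 + t2 * t3 * t4"
  define g where "g = t1 * t2 * t3 * t4"
  have "2 * (t1 * t2 + t1 * t3 + t1 * t4 + t2 * t3 + t2 * t4 + t3 * t4) = 2 * -4"
    using 1 2 by Groebner_Basis.algebra
  then have e2: "t1 * t2 + t1 * t3 + t1 * t4 + t2 * t3 + t2 * t4 + t3 * t4 = -4"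
    by (subst (asm) mult_cancel_left) simp
  have root: "t ^ 4 = 4 * t\<^sup>2 + e * t - g" if "t \<in> {t1, t2, t3, t4}" for t
  proof -
    have "(t - t1) * (t - t2) * (t - t3) * (t - t4) = 0" using that by auto
    moreover have "(t - t1) * (t - t2) * (t - t3) * (t - t4)
       = t ^ 4 - (t1 + t2 + t3 + t4) * t ^ 3
       + (t1 * t2 + t1 * t3 + t1 * t4 + t2 * t3 + t2 * t4 + t3 * t4) * t\<^sup>2 - e * t + g"
      unfolding e_def g_def by Groebner_Basis.algebra
    ultimately show ?thesis unfolding 1 e2 by Groebner_Basis.algebra
  qed
  have T4: "(t\<^sup>2 - 2)\<^sup>2 - 2 = e * t - g + 2" if "t \<in> {t1, t2, t3, t4}" for t
    using root[OF that] by Groebner_Basis.algebra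
  have "e * (t1 + t2 + t3 + t4) - 4 * g + 8 = 0"
    using 4 T4[of t1] T4[of t2] T4[of t3] T4[of t4] by (simp add: algebra_simps)
  then have g: "g = 2" using 1 by simp
  have "(e * t1)\<^sup>2 + (e * t2)\<^sup>2 + (e * t3)\<^sup>2 + (e * t4)\<^sup>2 = 8"
    using 8 T4[of t1] T4[of t2] T4[of t3] T4[of t4] g by (simp add: algebra_simps)
  then have "e\<^sup>2 * (t1\<^sup>2 + t2\<^sup>2 + t3\<^sup>2 + t4\<^sup>2) = 8"
    by (simp add: power_mult_distrib distrib_left)
  moreover have "t1\<^sup>2 + t2\<^sup>2 + t3\<^sup>2 + t4\<^sup>2 = 8" using 2 by Groebner_Basis.algebra
  ultimately have "e\<^sup>2 = 1" by simp
  then have e1: "e = 1 \<or> e = -1" by (simp add: power2_eq_1_iff)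
  have prod: "(y - t1) * (y - t2) * (y - t3) * (y - t4) = y ^ 4 - 4 * y\<^sup>2 - e * y + 2" for y
  proof -
    have "(y - t1) * (y - t2) * (y - t3) * (y - t4)
       = y ^ 4 - (t1 + t2 + t3 + t4) * y ^ 3
       + (t1 * t2 + t1 * t3 + t1 * t4 + t2 * t3 + t2 * t4 + t3 * t4) * y\<^sup>2 - e * y + g"
      unfolding e_def g_def by Groebner_Basis.algebra
    then show ?thesis unfolding 1 e2 g by simp
  qed
  have "e \<noteq> -1" using prod[of "-2"] n by auto
  with e1 have e: "e = 1" by simp
  have "2 \<in> {t1, t2, t3, t4}" using prod[of 2] e by auto
  moreover have "-1 \<in> {t1, t2, t3, t4}" using prod[of "-1"] e by auto
  moreover have "t = 2 \<or> t = -1 \<or> t\<^sup>2 + t - 1 = 0" if "t \<in> {t1, t2, t3, t4}" for t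
  proof -
    have "(t - 2) * (t + 1) * (t\<^sup>2 + t - 1) = 0"
      using root[OF that] e g by Groebner_Basis.algebra
    then show ?thesis by (auto simp: add_eq_0_iff2)
  qed
  ultimately show ?thesis by blast
qed

text \<open>Here \<open>u\<close> is the trace with the deviating sign. The first two equations
  leave only the product \<open>v\<close> of the other traces open; the third gives
  \<open>u * v = 1 - 2 * u\<^sup>2\<close> and the fourth \<open>v = u\<^sup>2\<close> up to sign.
  The wrong sign leads to the values of \<open>u\<close> that \<open>n\<close> excludes.\<close>

lemma three_traces:
  fixes t1 :: complex
  assumes 1: "t1 + t2 + t3 = u"
    and 2: "(t1\<^sup>2 - 2) + (t2\<^sup>2 - 2) + (t3\<^sup>2 - 2) = u\<^sup>2 - 2"
    and 4: "((t1\<^sup>2 - 2)\<^sup>2 - 2) + ((t2\<^sup>2 - 2)\<^sup>2 - 2) + ((t3\<^sup>2 - 2)\<^sup>2 - 2) = (u\<^sup>2 - 2)\<^sup>2 - 2"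
    and 8: "(((t1\<^sup>2 - 2)\<^sup>2 - 2)\<^sup>2 - 2) + (((t2\<^sup>2 - 2)\<^sup>2 - 2)\<^sup>2 - 2)
      + (((t3\<^sup>2 - 2)\<^sup>2 - 2)\<^sup>2 - 2) = ((u\<^sup>2 - 2)\<^sup>2 - 2)\<^sup>2 - 2"
    and n: "u \<noteq> 1" "u\<^sup>2 - u - 1 \<noteq> 0"
  shows "(u = -1 \<or> u\<^sup>2 + u - 1 = 0) \<and> t1 ^ 3 = u * t1\<^sup>2 + 2 * t1 + u\<^sup>2"
proof -
  define v where "v = t1 * t2 * t3"
  have p2: "t1\<^sup>2 + t2\<^sup>2 + t3\<^sup>2 = u\<^sup>2 + 4" using 2 by Groebner_Basis.algebra
  have "2 * (t1 * t2 + t1 * t3 + t2 * t3) = (t1 + t2 + t3)\<^sup>2 - (t1\<^sup>2 + t2\<^sup>2 + t3\<^sup>2)"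
      by Groebner_Basis.algebra
  also have "\<dots> = 2 * -2" unfolding p2 1 by simp
  finally have e2: "t1 * t2 + t1 * t3 + t2 * t3 = -2" by (subst (asm) mult_cancel_left) simp
  have root: "t ^ 3 = u * t\<^sup>2 + 2 * t + v" if "t \<in> {t1, t2, t3}" for t
  proof -
    have "(t - t1) * (t - t2) * (t - t3) = 0" using that by auto
    moreover have "(t - t1) * (t - t2) * (t - t3)
       = t ^ 3 - (t1 + t2 + t3) * t\<^sup>2 + (t1 * t2 + t1 * t3 + t2 * t3) * t - v"
      unfolding v_def by Groebner_Basis.algebra
    ultimately show ?thesis unfolding 1 e2 by Groebner_Basis.algebra
  qed
  have p3: "t1 ^ 3 + t2 ^ 3 + t3 ^ 3 = u ^ 3 + 6 * u + 3 * v"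
    using root[of t1] root[of t2] root[of t3] p2 1 by simp Groebner_Basis.algebra
  have p4: "t1 ^ 4 + t2 ^ 4 + t3 ^ 4 = u ^ 4 + 12"
    using 4 p2 by Groebner_Basis.algebra
  have t4: "t ^ 4 = u * t ^ 3 + 2 * t\<^sup>2 + v * t" if "t \<in> {t1, t2, t3}" for t
    using root[OF that] by Groebner_Basis.algebra
  have "t1 ^ 4 + t2 ^ 4 + t3 ^ 4 = u * (u ^ 3 + 6 * u + 3 * v) + 2 * (u\<^sup>2 + 4) + v * u"
    using t4[of t1] t4[of t2] t4[of t3] p2[symmetric] p3[symmetric] 1 by simp Groebner_Basis.algebra
  then have uv: "u * v = 1 - 2 * u\<^sup>2" using p4 by Groebner_Basis.algebra
  \<comment> \<open>Modulo the cubic each second iterate is quadratic in \<open>t\<close>, so its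
    square needs power sums only up to degree 4.\<close>
  define A where "A = u\<^sup>2 - 2"
  define B where "B = 2 * u + v"
  define C where "C = u * v + 2"
  have T4: "(t\<^sup>2 - 2)\<^sup>2 - 2 = A * t\<^sup>2 + B * t + C" if "t \<in> {t1, t2, t3}" for t
    using root[OF that] unfolding A_def B_def C_def by Groebner_Basis.algebra
  have sq: "(A * t\<^sup>2 + B * t + C)\<^sup>2 = A\<^sup>2 * t ^ 4 + 2 * A * B * t ^ 3 + (B\<^sup>2 + 2 * A * C) * t\<^sup>2
      + 2 * B * C * t + C\<^sup>2" for t
    by Groebner_Basis.algebra
  have "((u\<^sup>2 - 2)\<^sup>2 - 2)\<^sup>2 + 4 = (A * t1\<^sup>2 + B * t1 + C)\<^sup>2 + (A * t2\<^sup>2 + B * t2 + C)\<^sup>2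
      + (A * t3\<^sup>2 + B * t3 + C)\<^sup>2"
    using 8 unfolding T4[of t1, simplified] T4[of t2, simplified] T4[of t3, simplified]
        by Groebner_Basis.algebra
  also have "\<dots> = A\<^sup>2 * (t1 ^ 4 + t2 ^ 4 + t3 ^ 4) + 2 * A * B * (t1 ^ 3 + t2 ^ 3 + t3 ^ 3)
      + (B\<^sup>2 + 2 * A * C) * (t1\<^sup>2 + t2\<^sup>2 + t3\<^sup>2) + 2 * B * C * (t1 + t2 + t3) + 3 * C\<^sup>2"
    unfolding sq by Groebner_Basis.algebra
  also have "\<dots> = A\<^sup>2 * (u ^ 4 + 12) + 2 * A * B * (u ^ 3 + 6 * u + 3 * v)
      + (B\<^sup>2 + 2 * A * C) * (u\<^sup>2 + 4) + 2 * B * C * u + 3 * C\<^sup>2"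
    unfolding p4 p3 p2 1 ..
  finally have "v\<^sup>2 = (u\<^sup>2)\<^sup>2"
    unfolding A_def B_def C_def using uv by Groebner_Basis.algebra
  then consider "v = u\<^sup>2" | "v = - (u\<^sup>2)" unfolding power2_eq_iff by blast
  then have v: "v = u\<^sup>2"
  proof cases
    case 2
    then have "(u - 1) * (u\<^sup>2 - u - 1) = 0" using uv by Groebner_Basis.algebra
    then show ?thesis using n by simp
  qed
  then have "(u + 1) * (u\<^sup>2 + u - 1) = 0" using uv by Groebner_Basis.algebra
  then show ?thesis using root[of t1] v by (auto simp: add_eq_0_iff2)
qed

text \<open>A trace determines its ratio up to inversion: \<open>x / y\<close> is
  \<open>x / z\<close> or \<open>z / x\<close>.\<close>

lemma trace_eqD:
  fixes x y z :: complex
  assumes "x \<noteq> 0" "y \<noteq> 0" "z \<noteq> 0" "x / y + y / x = x / z + z / x"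
  shows "y = z \<or> x\<^sup>2 = y * z"
proof -
  have "x * ((x\<^sup>2 + y\<^sup>2) * z) = x * ((x\<^sup>2 + z\<^sup>2) * y)"
    using assms by (simp add: field_simps power2_eq_square)
  then have "(x\<^sup>2 + y\<^sup>2) * z = (x\<^sup>2 + z\<^sup>2) * y"
    using assms(1) by (subst (asm) mult_cancel_left) simp
  then have "(y - z) * (x\<^sup>2 - y * z) = 0" by Groebner_Basis.algebra
  then show ?thesis by auto
qed

section \<open>Orders of roots of unity read off from their traces\<close>

lemma trace_poly:
  fixes r t :: complex
  assumes "r \<noteq> 0" "t = r + 1 / r"
  shows "r\<^sup>2 = t * r - 1"
  using assms by (simp add: field_simps power2_eq_square)

lemma trace_minus_one: assumes "(r::complex) \<noteq> 0" "r + 1 / r = -1" shows "r ^ 3 = 1"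
  using trace_poly[OF assms(1) refl] unfolding assms(2) by Groebner_Basis.algebra

lemma trace_third_root:
  assumes "(r::complex) ^ 3 = 1" shows "r = 1 \<or> r + 1 / r = -1"
proof -
  have r: "r \<noteq> 0" using assms by auto
  define t where "t = r + 1 / r"
  have "(r - 1) * (r * (t + 1)) = 0"
    using trace_poly[OF r t_def] assms by Groebner_Basis.algebra
  then have "r = 1 \<or> t + 1 = 0" using r by simp
  then show ?thesis by (auto simp: t_def add_eq_0_iff2)
qed

lemma trace_one: assumes "(r::complex) \<noteq> 0" "r + 1 / r = 1" shows "r ^ 3 = -1"
  using trace_poly[OF assms(1) refl] unfolding assms(2) by Groebner_Basis.algebra

lemma trace_two: assumes "(r::complex) \<noteq> 0" "r + 1 / r = 2" shows "r = 1"
proof -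
  have "(r - 1)\<^sup>2 = 0"
    using trace_poly[OF assms(1) refl] unfolding assms(2) by Groebner_Basis.algebra
  then show ?thesis by simp
qed

lemma trace_minus_two: assumes "(r::complex) \<noteq> 0" "r + 1 / r = -2" shows "r = -1"
proof -
  have "(r + 1)\<^sup>2 = 0"
    using trace_poly[OF assms(1) refl] unfolding assms(2) by Groebner_Basis.algebra
  then show ?thesis by (simp add: add_eq_0_iff2)
qed

lemma trace_golden:
  assumes "(r::complex) \<noteq> 0" "(r + 1 / r)\<^sup>2 + (r + 1 / r) - 1 = 0" shows "r ^ 5 = 1"
proof -
  define t where "t = r + 1 / r"
  show ?thesis using trace_poly[OF assms(1) t_def] assms(2) unfolding t_def[symmetric]
      by Groebner_Basis.algebra
qed

lemma trace_golden_minus: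
  assumes "(r::complex) \<noteq> 0" "(r + 1 / r)\<^sup>2 - (r + 1 / r) - 1 = 0" shows "r ^ 5 = -1"
proof -
  define t where "t = r + 1 / r"
  show ?thesis using trace_poly[OF assms(1) t_def] assms(2) unfolding t_def[symmetric]
      by Groebner_Basis.algebra
qed

text \<open>The cubic is the minimal polynomial of 2 cos(2 pi / 7), whose roots are the traces of
  the primitive seventh roots of unity.\<close>

lemma trace_seventh:
  assumes "(r::complex) \<noteq> 0" "(r + 1 / r) ^ 3 = - (r + 1 / r)\<^sup>2 + 2 * (r + 1 / r)
      + 1" shows "r ^ 7 = 1"
proof -
  define t where "t = r + 1 / r"
  show ?thesis using trace_poly[OF assms(1) t_def] assms(2) unfolding t_def[symmetric]
      by Groebner_Basis.algebra
qed

lemma trace_fifth_root: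
  assumes "(r::complex) ^ 5 = 1" shows "r = 1 \<or> (r + 1 / r)\<^sup>2 + (r + 1 / r) - 1 = 0"
proof -
  have r: "r \<noteq> 0" using assms by auto
  define t where "t = r + 1 / r"
  have "(r - 1) * (r\<^sup>2 * (t\<^sup>2 + t - 1)) = 0"
    using trace_poly[OF r t_def] assms by Groebner_Basis.algebra
  then show ?thesis using r by (auto simp: t_def)
qed

text \<open>The only candidates for \<open>t\<close> are 2, \<open>u\<close> and the conjugate
  \<open>- 1 - u\<close>; each violates the cubic, which is the one from
  \<open>three_traces\<close>.\<close>

lemma golden_trace_contradiction:
  fixes u t :: complex
  assumes "u\<^sup>2 + u - 1 = 0" "t = 2 \<or> t\<^sup>2 + t - 1 = 0" "t ^ 3 = u * t\<^sup>2 + 2 * t + u\<^sup>2"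
  shows False
proof -
  have "t\<^sup>2 + t - 1 = 0"
  proof (rule ccontr)
    assume "\<not> ?thesis"
    then have "t = 2" using assms by blast
    then have "8 = 4 * u + 4 + u\<^sup>2" using assms(3) by (simp add: mult.commute)
    then have "3 * u = 3" using assms(1) by Groebner_Basis.algebra
    then show False using assms(1) by simp
  qed
  then have "(t - u) * (t + 1 + u) = 0" using assms(1) by Groebner_Basis.algebra
  then have "t = u \<or> t + 1 + u = 0" by simp
  moreover have "t = - 1 - u" if "t + 1 + u = 0" using that by Groebner_Basis.algebra
  ultimately consider "t = u" | "t = - 1 - u" by blast
  then show False
  proof cases
    case 1
    then have "u * (u + 2) = 0"
      using assms(3) by (simp add: power2_eq_square power3_eq_cube algebra_simps)
    then show False using assms(1) by (auto simp: add_eq_0_iff2)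
  next
    case 2
    then have "t ^ 3 = - 3 - 2 * u" "u * t\<^sup>2 + 2 * t + u\<^sup>2 = - 2 * u"
      using assms(1) by Groebner_Basis.algebra+
    then show False using assms(3) by simp
  qed
qed

section \<open>Perfect sequences on the cube\<close>

declare add_bit_eq_xor [simp del] mult_bit_eq_and [simp del]

text \<open>A basis of F_2^3, encoded by keeping each vector out of the span of the earlier
  ones.\<close>

definition independent :: "cube \<Rightarrow> cube \<Rightarrow> cube \<Rightarrow> bool" where
  "independent s p q \<longleftrightarrow> s \<noteq> 0 \<and> p \<notin> {0, s} \<and> q \<notin> {0, s, p, p + s}"

lemma card_cube: "card (UNIV :: cube set) = 8"
proof -
  have "(UNIV :: bit set) = {0, 1}"
    using bit_not_zero_iff by blast
  then have "card (UNIV :: bit set) = 2" by (metis card_2_iff zero_neq_one)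
  then show ?thesis
    by (simp add: UNIV_Times_UNIV[symmetric] card_cartesian_product del: UNIV_Times_UNIV)
qed

lemma finite_cube [simp]: "finite (A :: cube set)"
  using card_cube by (metis card.infinite finite_subset subset_UNIV zero_neq_numeral)

lemma independent_exists:
  assumes "s \<noteq> 0"
  obtains p q where "independent s p q"
proof -
  have ex: "\<exists>p. p \<notin> set xs" if "length xs < 8" for xs :: "cube list"
  proof (rule ccontr)
    assume "\<not> ?thesis"
    then have "set xs = UNIV" by auto
    then show False using card_length[of xs] card_cube that by simp
  qed
  obtain p where "p \<notin> set [0, s]" using ex[of "[0, s]"] by auto
  moreover obtain q where "q \<notin> set [0, s, p, p + s]" using ex[of "[0, s, p, p + s]"] by auto
  ultimately show ?thesis using that[of p q] assms by (simp add: independent_def)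
qed

lemma cube_sum_translate: "(\<Sum>x\<in>UNIV. h (o' + x)) = (\<Sum>x\<in>UNIV. h (x :: cube))"
  by (rule sum.reindex_bij_witness[of _ "\<lambda>x. o' + x" "\<lambda>x. o' + x"]) simp_all

text \<open>Points are paired along \<open>s\<close> because the terms of an autocorrelation at
  \<open>x\<close> and \<open>x + s\<close> carry inverse ratios. The base point \<open>x0\<close>
  is free, so that a distinguished pair can come first.\<close>

lemma sum_cube_independent:
  assumes "independent s p q"
  shows "(\<Sum>x\<in>UNIV. h (x :: cube)) =
    (\<Sum>z\<leftarrow>[0, p, q, p + q]. h (x0 + z) + h (x0 + z + s))"
proof -
  let ?L = "[0, p, q, p + q, s, p + s, q + s, p + q + s]"
  have "distinct ?L"
    using assms unfolding independent_def
    by (auto simp: cube_sum_eq_iff ac_simps)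
  then have "card (set ?L) = 8" by (simp only: distinct_card) simp
  then have U: "UNIV = set ?L"
    using card_cube by (intro card_subset_eq[symmetric]) simp_all
  have "(\<Sum>x\<in>UNIV. h x) = (\<Sum>x\<in>UNIV. h (x0 + x))" by (rule cube_sum_translate[symmetric])
  also have "\<dots> = (\<Sum>x\<leftarrow>?L. h (x0 + x))"
    unfolding U by (rule sum.distinct_set_conv_list[OF \<open>distinct ?L\<close>])
  finally show ?thesis by (simp add: ac_simps)
qed

text \<open>Roots of unity of order dividing \<open>2 * k\<close> with \<open>k\<close> odd cover
  both kinds of modulus at once.\<close>

locale bent_cube =
  fixes a :: "cube \<Rightarrow> complex" and k :: nat
  assumes odd_k: "odd k"
    and root: "a x ^ (2 * k) = 1"
    and autocorrelation: "s \<noteq> 0 \<Longrightarrow> (\<Sum>x\<in>UNIV. a x * cnj (a (x + s))) = 0"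
begin

text \<open>The decomposition \<open>a = \<plusminus> w\<close> into a sign \<open>(-1) ^ n\<close> and a root of unity of odd order.\<close>

definition w :: "cube \<Rightarrow> complex" where "w x = a x ^ k * a x"

definition n :: "cube \<Rightarrow> bit" where "n x = (if a x ^ k = 1 then 0 else 1)"

definition sg :: "bit \<Rightarrow> int" where "sg b = (if b = 0 then 1 else -1)"

lemma sg_simps [simp]: "sg 0 = 1" "sg 1 = -1" "sg (b + 1) = - sg b" "sg (1 + b) = - sg b"
  by (cases b; simp add: sg_def)+

lemma sg_nonzero [simp]: "sg b \<noteq> 0"
  by (simp add: sg_def)

lemma k_pos: "k > 0"
  using odd_k by (cases k) auto

lemma power_k: "a x ^ k = of_int (sg (n x))"
proof -
  have "(a x ^ k)\<^sup>2 = 1" using root[of x] by (simp add: power_mult[symmetric] mult.commute)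
  then show ?thesis by (auto simp: n_def sg_def power2_eq_1_iff)
qed

lemma w_power [simp]: "w x ^ k = 1"
  using odd_k by (cases "n x") (auto simp: w_def power_k power_mult_distrib)

lemma w_nonzero [simp]: "w x \<noteq> 0"
  using w_power[of x] k_pos by (metis power_0_left not_gr_zero zero_neq_one)

lemma a_eq: "a x = of_int (sg (n x)) * w x"
  unfolding w_def power_k by (cases "n x") simp_all

lemma norm_w: "cmod (w x) = 1"
  using w_power[of x] k_pos by (metis norm_ge_zero norm_one norm_power power_eq_1_iff not_gr_zero)

lemma a_cnj: "a x * cnj (a y) = of_int (sg (n x + n y)) * (w x / w y)"
proof -
  have "cnj (w y) = 1 / w y"
    using complex_norm_square[of "w y"] by (simp add: norm_w field_simps)
  then show ?thesis by (cases "n x"; cases "n y") (simp_all add: a_eq)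
qed

lemma root_power_neq_minus_one:
  assumes "r ^ k = 1" shows "r ^ i \<noteq> (-1 :: complex)"
proof
  assume "r ^ i = -1"
  then have "(r ^ k) ^ i = (-1) ^ k" by (metis power_mult mult.commute)
  then show False using assms odd_k by simp
qed

lemma w_square_inj: "(w x)\<^sup>2 = (w y)\<^sup>2 \<Longrightarrow> w x = w y"
proof -
  assume "(w x)\<^sup>2 = (w y)\<^sup>2"
  then have "w x = w y \<or> w x = - w y" by (simp add: power2_eq_iff)
  moreover have "w x \<noteq> - w y"
  proof
    assume "w x = - w y"
    then have "w x ^ k = - (w y ^ k)" using odd_k by simp
    then show False by simp
  qed
  ultimately show ?thesis by simp
qed

section \<open>Trace equations along one direction\<close>

definition T :: "cube \<Rightarrow> cube \<Rightarrow> complex" where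
  "T x y = w x / w y + w y / w x"

lemma T_trace: "T x y = w x / w y + 1 / (w x / w y)"
  by (simp add: T_def)

lemma ratio_power: "(w x / w y) ^ k = 1"
  by (simp add: power_divide)

text \<open>The excluded values are traces of ratios \<open>r\<close> with \<open>r = -1\<close>,
  \<open>r ^ 3 = -1\<close> or \<open>r ^ 5 = -1\<close>, but no power of an element of odd order is
  -1.\<close>

lemma T_neq: "T x y \<noteq> -2" "T x y \<noteq> 1" "(T x y)\<^sup>2 - T x y - 1 \<noteq> 0"
  using root_power_neq_minus_one[OF ratio_power[of x y], of 1]
    root_power_neq_minus_one[OF ratio_power[of x y], of 3]
    root_power_neq_minus_one[OF ratio_power[of x y], of 5]
    trace_minus_two[of "w x / w y"] trace_one[of "w x / w y"] trace_golden_minus[of "w x / w y"]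
  by (auto simp: T_trace)

lemma T_eq_2: "T x y = 2 \<longleftrightarrow> w x = w y"
  using trace_two[of "w x / w y"] by (auto simp: T_trace)

text \<open>Starting from the autocorrelation, \<open>roots_of_unity_sum_square\<close> squares
  every ratio; the signs, being integers, stay.\<close>

lemma ratio_square_sums:
  assumes "s \<noteq> 0"
  shows "(\<Sum>x\<in>UNIV. of_int (sg (n x + n (x + s))) * ((w x / w (x + s)) ^ (2 ^ i))) = 0"
proof (induction i)
  case 0
  then show ?case using autocorrelation[OF assms] by (simp add: a_cnj)
next
  case (Suc i)
  have "((w x / w (x + s)) ^ 2 ^ i) ^ k = 1" for x
    by (metis ratio_power power_mult mult.commute power_one)
  from roots_of_unity_sum_square[OF odd_k this Suc.IH]
  show ?case by (simp add: power_mult[symmetric] mult.commute)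
qed

text \<open>Squaring a ratio acts on its trace as t -> t^2 - 2, so the exponents 1, 2, 4, 8 give
  four equations in the same four traces.\<close>

lemma direction_sums:
  fixes x0 :: cube
  assumes "independent s p q"
  defines "c \<equiv> \<lambda>z. of_int (sg (n (x0 + z) + n (x0 + z + s)))"
    and "t \<equiv> \<lambda>z. T (x0 + z) (x0 + z + s)"
  shows "c 0 * t 0 + c p * t p + c q * t q + c (p + q) * t (p + q) = 0"
    and "c 0 * ((t 0)\<^sup>2 - 2) + c p * ((t p)\<^sup>2 - 2) + c q * ((t q)\<^sup>2 - 2)
      + c (p + q) * ((t (p + q))\<^sup>2 - 2) = 0"
    and "c 0 * (((t 0)\<^sup>2 - 2)\<^sup>2 - 2) + c p * (((t p)\<^sup>2 - 2)\<^sup>2 - 2) + c q * (((t q)\<^sup>2 - 2)\<^sup>2 - 2)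
      + c (p + q) * (((t (p + q))\<^sup>2 - 2)\<^sup>2 - 2) = 0"
    and "c 0 * ((((t 0)\<^sup>2 - 2)\<^sup>2 - 2)\<^sup>2 - 2) + c p * ((((t p)\<^sup>2 - 2)\<^sup>2 - 2)\<^sup>2 - 2)
      + c q * ((((t q)\<^sup>2 - 2)\<^sup>2 - 2)\<^sup>2 - 2)
      + c (p + q) * ((((t (p + q))\<^sup>2 - 2)\<^sup>2 - 2)\<^sup>2 - 2) = 0"
proof -
  define r where "r x y i = (w x / w y) ^ (2 ^ i) + (w y / w x) ^ (2 ^ i)" for x y i
  have s: "s \<noteq> 0" using assms(1) by (simp add: independent_def)
  have pair: "of_int (sg (n x + n (x + s))) * (w x / w (x + s)) ^ 2 ^ i
      + of_int (sg (n (x + s) + n (x + s + s))) * (w (x + s) / w (x + s + s)) ^ 2 ^ i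
      = of_int (sg (n x + n (x + s))) * r x (x + s) i" for x i
    by (simp add: r_def distrib_left add.assoc add.commute[of "n x"])
  have *: "(\<Sum>z\<leftarrow>[0, p, q, p + q]. c z * r (x0 + z) (x0 + z + s) i) = 0" for i
    using ratio_square_sums[OF s, of i]
    unfolding sum_cube_independent[OF assms(1), of _ x0] pair c_def .
  have rS: "r x y (Suc i) = (r x y i)\<^sup>2 - 2" for x y i
  proof -
    have "(w x / w y) ^ 2 ^ i * (w y / w x) ^ 2 ^ i = 1"
      by (simp add: power_mult_distrib[symmetric])
    then show ?thesis
      by (simp add: r_def power2_sum power_mult[symmetric] mult.commute)
  qed
  have r0: "r x y 0 = T x y" for x y by (simp add: r_def T_def)
  show "c 0 * t 0 + c p * t p + c q * t q + c (p + q) * t (p + q) = 0"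
    using *[of 0] by (simp add: r0 t_def ac_simps)
  show "c 0 * ((t 0)\<^sup>2 - 2) + c p * ((t p)\<^sup>2 - 2) + c q * ((t q)\<^sup>2 - 2)
      + c (p + q) * ((t (p + q))\<^sup>2 - 2) = 0"
    using *[of "Suc 0"] unfolding rS r0 by (simp add: t_def add.assoc)
  show "c 0 * (((t 0)\<^sup>2 - 2)\<^sup>2 - 2) + c p * (((t p)\<^sup>2 - 2)\<^sup>2 - 2) + c q * (((t q)\<^sup>2 - 2)\<^sup>2 - 2)
      + c (p + q) * (((t (p + q))\<^sup>2 - 2)\<^sup>2 - 2) = 0"
    using *[of "Suc (Suc 0)"] unfolding rS r0 by (simp add: t_def add.assoc)
  show "c 0 * ((((t 0)\<^sup>2 - 2)\<^sup>2 - 2)\<^sup>2 - 2) + c p * ((((t p)\<^sup>2 - 2)\<^sup>2 - 2)\<^sup>2 - 2)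
      + c q * ((((t q)\<^sup>2 - 2)\<^sup>2 - 2)\<^sup>2 - 2)
      + c (p + q) * ((((t (p + q))\<^sup>2 - 2)\<^sup>2 - 2)\<^sup>2 - 2) = 0"
    using *[of "Suc (Suc (Suc 0))"] unfolding rS r0 by (simp add: t_def add.assoc)
qed

lemma constant_direction:
  fixes x0 :: cube
  assumes "independent s p q" and "\<And>x. n x + n (x + s) = b"
  defines "t \<equiv> \<lambda>z. T (x0 + z) (x0 + z + s)"
  shows "2 \<in> {t 0, t p, t q, t (p + q)} \<and> -1 \<in> {t 0, t p, t q, t (p + q)} \<and>
     (\<forall>t\<in>{t 0, t p, t q, t (p + q)}. t = 2 \<or> t = -1 \<or> t\<^sup>2 + t - 1 = 0) \<and>
     t 0 + t p + t q + t (p + q) = 0"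
proof -
  define c where "c = complex_of_int (sg b)"
  have c: "c = 1 \<or> c = -1" by (simp add: c_def sg_def)
  note d = direction_sums[OF assms(1), of x0, unfolded assms(2), folded c_def]
  have scale: "x + y + z + v = 0" if "c * x + c * y + c * z + c * v = 0" for x y z v
    using c that by (metis distrib_left mult_eq_0_iff neg_equal_0_iff_equal zero_neq_one)
  have 1: "t 0 + t p + t q + t (p + q) = 0"
    unfolding t_def by (rule scale, rule d(1))
  have 2: "((t 0)\<^sup>2 - 2) + ((t p)\<^sup>2 - 2) + ((t q)\<^sup>2 - 2) + ((t (p + q))\<^sup>2 - 2) = 0"
    unfolding t_def by (rule scale, rule d(2))
  have 4: "(((t 0)\<^sup>2 - 2)\<^sup>2 - 2) + (((t p)\<^sup>2 - 2)\<^sup>2 - 2) + (((t q)\<^sup>2 - 2)\<^sup>2 - 2)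
      + (((t (p + q))\<^sup>2 - 2)\<^sup>2 - 2) = 0"
    unfolding t_def by (rule scale, rule d(3))
  have 8: "((((t 0)\<^sup>2 - 2)\<^sup>2 - 2)\<^sup>2 - 2) + ((((t p)\<^sup>2 - 2)\<^sup>2 - 2)\<^sup>2 - 2)
      + ((((t q)\<^sup>2 - 2)\<^sup>2 - 2)\<^sup>2 - 2) + ((((t (p + q))\<^sup>2 - 2)\<^sup>2 - 2)\<^sup>2 - 2) = 0"
    unfolding t_def by (rule scale, rule d(4))
  have "-2 \<notin> {t 0, t p, t q, t (p + q)}" using T_neq(1)[symmetric] by (simp add: t_def)
  from four_traces[OF 1 2 4 8 this] 1 show ?thesis by blast
qed

lemma constant_direction_exists:
  assumes "independent s p q" and "\<And>x. n x + n (x + s) = b"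
  shows "\<exists>x. T x (x + s) = 2" "\<exists>x. T x (x + s) = -1"
proof -
  define t where "t z = T (0 + z) (0 + z + s)" for z
  have "2 \<in> {t 0, t p, t q, t (p + q)}" "-1 \<in> {t 0, t p, t q, t (p + q)}"
    using constant_direction[OF assms, of 0] unfolding t_def by blast+
  then have "\<exists>z. t z = 2" "\<exists>z. t z = -1" by (metis empty_iff insert_iff)+
  then show "\<exists>x. T x (x + s) = 2" "\<exists>x. T x (x + s) = -1" by (auto simp: t_def)
qed


section \<open>Exclusion of the three sign patterns\<close>

text \<open>
  Every ratio \<open>w u / w x\<close> has order dividing 3 or 5, which excludes the seventh roots of unity, so
  that all these orders divide 5; but then the remaining traces of a direction are not those of
  fifth roots of unity.
\<close>
lemma no_point_case:
  assumes "\<And>s x. s \<noteq> 0 \<Longrightarrow> x \<noteq> u \<Longrightarrow> x \<noteq> u + s \<Longrightarrow> n x + n (x + s) = n u + n (u + s) + 1"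
  shows False
proof -
  have traces: "(T u (u + s) = -1 \<or> (T u (u + s))\<^sup>2 + T u (u + s) - 1 = 0) \<and>
      (\<exists>y. T y (y + s) ^ 3 = T u (u + s) * (T y (y + s))\<^sup>2 + 2 * T y (y + s) + (T u (u + s))\<^sup>2)"
    if s: "s \<noteq> 0" for s
  proof -
    obtain p q where i: "independent s p q" by (rule independent_exists[OF s])
    define c where "c = complex_of_int (sg (n u + n (u + s)))"
    have c: "c \<noteq> 0" by (simp add: c_def)
    have "n (u + z) + n (u + z + s) = n u + n (u + s) + 1" if "z \<in> {p, q, p + q}" for z
    proof (rule assms[OF s])
      show "u + z \<noteq> u" "u + z \<noteq> u + s"
        using i that unfolding independent_def by (auto simp: cube_sum_eq_iff add.commute)
    qed
    then have sg: "complex_of_int (sg (n (u + z) + n (u + z + s))) = - c" if "z \<in> {p, q, p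
        + q}" for z
      using that by (simp add: c_def)
    have scale: "y + z + v = x" if "c * x + - c * y + - c * z + - c * v = 0" for x y z v
    proof -
      have "c * (y + z + v) = c * x" using that by (simp add: algebra_simps)
      then show ?thesis using c by simp
    qed
    \<comment> \<open>With base point \<open>u\<close>, only the pair of \<open>u\<close> has sign
      \<open>c\<close> and the other three have \<open>- c\<close>, as \<open>three_traces\<close>
      requires.\<close>
    note d = direction_sums[OF i, of u, unfolded add_0_right sg[of p, simplified] sg[of q,
        simplified]
        sg[of "p + q", simplified], folded c_def]
    show ?thesis
      using three_traces[OF scale[OF d(1)] scale[OF d(2)] scale[OF d(3)] scale[OF d(4)] T_neq(2,3)]
      by blast
  qed
  have ratio: "(w u / w x) ^ 3 = 1 \<or> (w u / w x) ^ 5 = 1" for x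
  proof (cases "x = u")
    case False
    then have "u + x \<noteq> 0" by (metis add_0_right cube_double_left)
    from traces[OF this] show ?thesis
      using trace_minus_one[of "w u / w x"] trace_golden[of "w u / w x"]
      by (auto simp: T_trace)
  qed simp
  have "(w u / w x) ^ 15 = 1" for x
  proof -
    have "(w u / w x) ^ 15 = ((w u / w x) ^ 3) ^ 5" "(w u / w x) ^ 15 = ((w u / w x) ^ 5) ^ 3"
      by (simp_all flip: power_mult)
    then show ?thesis using ratio[of x] by (metis power_one)
  qed
  then have r15: "(w x / w y) ^ 15 = 1" for x y
  proof -
    have "w x / w y = (w u / w y) / (w u / w x)" by simp
    then show ?thesis using \<open>\<And>x. (w u / w x) ^ 15 = 1\<close> by (simp only: power_divide) simp
  qed
  have golden: "(T u (u + s))\<^sup>2 + T u (u + s) - 1 = 0" if s: "s \<noteq> 0" for s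
  proof (rule ccontr)
    assume "\<not> ?thesis"
    then have "T u (u + s) = -1" using traces[OF s] by blast
    \<comment> \<open>For \<open>T u (u + s) = -1\<close> the cubic is that of the primitive seventh
      roots of unity; an order dividing 7 and 15 leaves \<open>r = 1\<close>, whose trace 2 is no
      root.\<close>
    then obtain y where y: "T y (y + s) ^ 3 = - (T y (y + s))\<^sup>2 + 2 * T y (y + s) + 1"
      using traces[OF s] by auto
    define r where "r = w y / w (y + s)"
    have "r ^ 7 = 1" using y unfolding T_trace r_def by (intro trace_seventh) simp_all
    moreover have "r ^ 15 = r ^ 7 * r ^ 7 * r" by (simp add: eval_nat_numeral)
    ultimately have "r = 1" using r15[of y "y + s"] by (simp add: r_def)
    then have "T y (y + s) = 2" by (simp add: T_trace r_def)
    then show False using y by simp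
  qed
  have "(w u / w x) ^ 5 = 1" for x
  proof (cases "x = u")
    case False
    then have "u + x \<noteq> 0" by (metis add_0_right cube_double_left)
    from golden[OF this] show ?thesis
      using trace_golden[of "w u / w x"] by (simp add: T_trace)
  qed simp
  then have r5: "(w x / w y) ^ 5 = 1" for x y
  proof -
    have "w x / w y = (w u / w y) / (w u / w x)" by simp
    then show ?thesis using \<open>\<And>x. (w u / w x) ^ 5 = 1\<close> by (simp only: power_divide) simp
  qed
  define s :: cube where "s = (1, 1, 1)"
  have s: "s \<noteq> 0" by (simp add: s_def zero_prod_def)
  obtain y where y: "T y (y + s) ^ 3 = T u (u + s) * (T y (y + s))\<^sup>2 + 2 * T y (y + s) + (T u (u
      + s))\<^sup>2"
    using traces[OF s] by blast
  have "T y (y + s) = 2 \<or> (T y (y + s))\<^sup>2 + T y (y + s) - 1 = 0"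
    using trace_fifth_root[OF r5[of y "y + s"]] T_eq_2 by (auto simp: T_trace)
  from golden_trace_contradiction[OF golden[OF s] this y] show False .
qed

text \<open>
  All ratios would lie in the union of the groups of third and fifth roots of unity, and hence, as
  one of order 3 occurs, in the former; but no direction has only ratios of order 1 and 3.
\<close>
lemma no_affine_case:
  assumes "\<And>s x. n x + n (x + s) = n 0 + n s"
  shows False
proof -
  have orders: "(w x / w y) ^ 3 = 1 \<or> (w x / w y) ^ 5 = 1" for x y
  proof (cases "x + y = 0")
    case True
    then have "x = y" by (metis add_0_right cube_double_left)
    then show ?thesis by simp
  next
    case False
    then obtain p q where "independent (x + y) p q" by (rule independent_exists)
    from constant_direction[OF this assms, of x]
    have "T x y = 2 \<or> T x y = -1 \<or> (T x y)\<^sup>2 + T x y - 1 = 0" by simp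
    then show ?thesis
      using trace_minus_one[of "w x / w y"] trace_golden[of "w x / w y"] T_eq_2[of x y]
      by (auto simp: T_trace)
  qed
  define s :: cube where "s = (1, 1, 1)"
  have s: "s \<noteq> 0" by (simp add: s_def zero_prod_def)
  then obtain p q where "independent s p q" by (rule independent_exists)
  then have c: "T (0 + 0) (0 + 0 + s) + T (0 + p) (0 + p + s) + T (0 + q) (0 + q + s)
        + T (0 + (p + q)) (0 + (p + q) + s) = 0"
    and "\<exists>x. T x (x + s) = -1"
    using constant_direction[OF \<open>independent s p q\<close> assms, of 0]
      constant_direction_exists[OF \<open>independent s p q\<close> assms] by blast+
  then obtain x where x: "T x (x + s) = -1" by blast
  have "\<exists>y. T y (y + s) \<noteq> 2 \<and> T y (y + s) \<noteq> -1"
  proof (rule ccontr)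
    assume "\<not> ?thesis"
    then have two_values: "T y (y + s) = 2 \<or> T y (y + s) = -1" for y by blast
    \<comment> \<open>Both values are 2 modulo 3, so four of them cannot sum to zero.\<close>
    have "t1 + t2 + t3 + t4 \<noteq> 0" if "t1 = 2 \<or> t1 = -1" "t2 = 2 \<or> t2 = -1" "t3 = 2 \<or> t3 = -1"
      "t4 = 2 \<or> t4 = -1" for t1 t2 t3 t4 :: complex
      using that by auto
    from this[OF two_values two_values two_values two_values] c show False by blast
  qed
  then obtain y where y: "T y (y + s) \<noteq> 2" "T y (y + s) \<noteq> -1" by blast
  have xr: "(w x / w (x + s)) ^ 3 = 1" "w x \<noteq> w (x + s)"
    using trace_minus_one[of "w x / w (x + s)"] x T_eq_2[of x "x + s"] by (auto simp: T_trace)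
  have "(w x / w z) ^ 3 = 1" for z
  proof (rule ccontr)
    assume n3: "(w x / w z) ^ 3 \<noteq> 1"
    then have x5: "(w x / w z) ^ 5 = 1" using orders by blast
    \<comment> \<open>The quotient of a ratio of order 5 by one of order 3 has order 15, but
      \<open>orders\<close> allows only the exponents 3 and 5 for
      \<open>w (x + s) / w z\<close>.\<close>
    have eq: "w x / w z = (w x / w (x + s)) * (w (x + s) / w z)" by simp
    show False
    proof (cases "(w (x + s) / w z) ^ 3 = 1")
      case True
      then have "(w x / w z) ^ 3 = 1" unfolding eq power_mult_distrib xr(1) by simp
      then show False using n3 by simp
    next
      case False
      then have "(w (x + s) / w z) ^ 5 = 1" using orders by blast
      then have "(w x / w (x + s)) ^ 5 = 1" using x5 unfolding eq power_mult_distrib by simp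
      moreover have "r = 1" if "r ^ 3 = 1" "r ^ 5 = 1" for r :: complex
      proof -
        have "r ^ 5 * r = (r ^ 3)\<^sup>2" by (simp add: eval_nat_numeral)
        then show ?thesis using that by simp
      qed
      ultimately have "w x / w (x + s) = 1" using xr(1) by blast
      then show False using xr(2) by simp
    qed
  qed
  then have "w x ^ 3 = w z ^ 3" for z by (simp add: power_divide)
  then have "(w y / w (y + s)) ^ 3 = 1" by (simp add: power_divide) (metis w_nonzero
      power_not_zero divide_self)
  from trace_third_root[OF this] show False
    using y T_eq_2[of y "y + s"] by (auto simp: T_trace)
qed

text \<open>
  Choose a coset \<open>{b, b + d}\<close> on which \<open>w\<close> is constant and two, \<open>{c, c + d}\<close> and \<open>{e, e
      + d}\<close>, on which
  it is not. Comparing the directions \<open>c + e\<close> and \<open>c + e + d\<close> through the traces at \<open>b\<close> shows that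
  the traces between the last two cosets agree in pairs.
\<close>
lemma no_line_case:
  assumes d: "d \<noteq> 0" and const: "\<And>x. n x + n (x + d) = n 0 + n d"
    and bal: "\<And>s x y. s \<noteq> 0 \<Longrightarrow> s \<noteq> d \<Longrightarrow> x + y \<notin> {0, s, d, s + d} \<Longrightarrow> n x + n (x + s) = n y + n (y + s)
        + 1"
  shows False
proof -
  obtain p' q' where i': "independent d p' q'" by (rule independent_exists[OF d])
  obtain b where b: "T b (b + d) = 2"
    using constant_direction_exists[OF i' const] by blast
  define N where "N z \<longleftrightarrow> T (b + z) (b + z + d) \<noteq> 2" for z
  \<comment> \<open>Besides the coset of \<open>b\<close> at most one other has trace 2: with two
    more, the last trace would be -6, which is not an admissible value.\<close>
  have "\<not> (\<not> N p' \<and> \<not> N q' \<or> \<not> N p' \<and> \<not> N (p' + q') \<or> \<not> N q' \<and> \<not> N (p' + q'))"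
  proof -
    define t where "t z = T (b + z) (b + z + d)" for z
    have t: "t 0 + t p' + t q' + t (p' + q') = 0"
      "\<And>z. z \<in> {p', q', p' + q'} \<Longrightarrow> t z = 2 \<or> t z = -1 \<or> (t z)\<^sup>2 + t z - 1 = 0"
      using constant_direction[OF i' const, of b] unfolding t_def by blast+
    have "t z + 6 \<noteq> 0" if "z \<in> {p', q', p' + q'}" for z
      using t(2)[OF that] by (auto simp: add_eq_0_iff2)
    then have "t p' + 6 \<noteq> 0" "t q' + 6 \<noteq> 0" "t (p' + q') + 6 \<noteq> 0" by blast+
    moreover have "t 0 = 2" using b by (simp add: t_def)
    then have "t p' = 2 \<Longrightarrow> t q' = 2 \<Longrightarrow> t (p' + q') + 6 = t 0 + t p' + t q' + t (p' + q')"
      "t p' = 2 \<Longrightarrow> t (p' + q') = 2 \<Longrightarrow> t q' + 6 = t 0 + t p' + t q' + t (p' + q')"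
      "t q' = 2 \<Longrightarrow> t (p' + q') = 2 \<Longrightarrow> t p' + 6 = t 0 + t p' + t q' + t (p' + q')"
      by simp_all
    ultimately show ?thesis
      unfolding N_def t_def[symmetric] t(1) by blast
  qed
  then consider "N p'" "N q'" | "N p'" "N (p' + q')" | "N q'" "N (p' + q')" by blast
  then obtain p q where i: "independent d p q" and N: "N p" "N q"
  proof cases
    case 1
    then show ?thesis using that i' by blast
  next
    case 2
    have "independent d p' (p' + q')" using i' unfolding independent_def
      by (auto simp: cube_sum_eq_iff ac_simps)
    then show ?thesis using that 2 by blast
  next
    case 3
    have "independent d q' (p' + q')" using i' unfolding independent_def
      by (auto simp: cube_sum_eq_iff ac_simps)
    then show ?thesis using that 3 by blast
  qed
  define c where "c = b + p"
  define e where "e = b + q"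
  have wb: "w (b + d) = w b" using b T_eq_2 by simp
  have wc: "w (c + d) \<noteq> w c" and we: "w (e + d) \<noteq> w e"
    using N T_eq_2 by (auto simp: N_def c_def e_def)
  have pairs: "T b (b + s) + T (b + d) (b + d + s) = T c (c + s) + T (c + d) (c + d + s) \<and>
     (T b (b + s))\<^sup>2 + (T (b + d) (b + d + s))\<^sup>2 = (T c (c + s))\<^sup>2 + (T (c + d) (c + d + s))\<^sup>2"
    if s: "s = p + q \<or> s = p + q + d" for s
  proof -
    \<comment> \<open>The points \<open>b\<close>, \<open>b + d\<close>, \<open>c\<close>,
      \<open>c + d\<close> represent the four cosets of \<open>s\<close>. The sign of a pair is
      unchanged under translation by \<open>d\<close>, by \<open>const\<close>, and flips from
      \<open>b\<close> to \<open>c\<close>, by \<open>bal\<close>.\<close>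
    have ind: "independent s d p" using i s unfolding independent_def
      by (auto simp: cube_sum_eq_iff ac_simps)
    define g where "g = complex_of_int (sg (n b + n (b + s)))"
    have g: "g \<noteq> 0" by (simp add: g_def)
    have nd: "n (x + d) + n (x + d + s) = n x + n (x + s)" for x
    proof -
      have "n x + n (x + d) = n (x + s) + n (x + d + s)"
        using const[of x] const[of "x + s"] by (simp add: ac_simps)
      then show ?thesis
        by (cases "n x"; cases "n (x + d)"; cases "n (x + s)"; cases "n (x + d + s)") simp_all
    qed
    have nb: "n (b + p) + n (b + p + s) = n b + n (b + s) + 1"
      by (rule bal) (use ind in \<open>auto simp: independent_def cube_sum_eq_iff ac_simps\<close>)
    have sgs: "complex_of_int (sg (n (b + d) + n (b + d + s))) = g"
      "complex_of_int (sg (n (b + p) + n (b + p + s))) = - g"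
      "complex_of_int (sg (n (b + (d + p)) + n (b + (d + p) + s))) = - g"
      using nd[of b] nb nd[of "b + p"] by (simp_all add: g_def ac_simps)
    have scale: "x + y = z + v" if "g * x + g * y + - g * z + - g * v = 0" for x y z v
    proof -
      have "g * (x + y) = g * (z + v)" using that by (simp add: algebra_simps)
      then show ?thesis using g by simp
    qed
    note d = direction_sums(1,2)[OF ind, of b, unfolded add_0_right sgs, folded g_def]
    show ?thesis using scale[OF d(1)] scale[OF d(2)] by (simp add: c_def ac_simps)
  qed
  have pe: "c + (p + q) = e" "c + d + (p + q) = e + d" "c + (p + q + d) = e + d" "c + d + (p + q
      + d) = e"
    by (simp_all add: c_def e_def ac_simps)
  have Tb: "T (b + d) x = T b x" "T x (b + d) = T x b" for x
    by (simp_all add: T_def wb)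
  note P = pairs[of "p + q", simplified, unfolded pe]
  note Q = pairs[of "p + q + d", simplified, unfolded pe]
  \<comment> \<open>As \<open>w (b + d) = w b\<close>, both directions meet the same two traces
    \<open>X\<close> and \<open>Y\<close> at \<open>b\<close>, so the corresponding pairs of traces
    between the cosets of \<open>c\<close> and \<open>e\<close> have equal power sums.\<close>
  have "T c e = T c (e + d) \<and> T (c + d) (e + d) = T (c + d) e \<or>
        T c e = T (c + d) e \<and> T (c + d) (e + d) = T c (e + d)"
  proof -
    have shift: "b + (p + q + d) = b + d + (p + q)" "b + d + (p + q + d) = b + (p + q)"
      by (simp_all add: ac_simps)
    define X where "X = T b (b + (p + q))"
    define Y where "Y = T b (b + d + (p + q))"
    have "X + Y = T c e + T (c + d) (e + d)" "X\<^sup>2 + Y\<^sup>2 = (T c e)\<^sup>2 + (T (c + d) (e + d))\<^sup>2"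
      using P unfolding Tb X_def Y_def by blast+
    moreover have "Y + X = T c (e + d) + T (c + d) e" "Y\<^sup>2 + X\<^sup>2 = (T c (e + d))\<^sup>2 + (T (c
        + d) e)\<^sup>2"
      using Q unfolding shift Tb X_def Y_def by blast+
    ultimately show ?thesis by (intro two_power_sums_eq) (metis add.commute)+
  qed
  \<comment> \<open>Either way each point of one coset has equal traces with both points of another,
    where \<open>w\<close> takes two values. By \<open>trace_eqD\<close> its square is the product
    of these values, so \<open>w\<close> is constant on the first coset.\<close>
  then show False
  proof (elim disjE conjE)
    assume "T c e = T c (e + d)" "T (c + d) (e + d) = T (c + d) e"
    then have "(w c)\<^sup>2 = w e * w (e + d)" "(w (c + d))\<^sup>2 = w (e + d) * w e"
      using we trace_eqD[of "w c" "w e" "w (e + d)"] trace_eqD[of "w (c + d)" "w (e + d)" "w e"]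
      by (auto simp: T_def)
    then show False using w_square_inj[of c "c + d"] wc by (simp add: mult.commute)
  next
    assume "T c e = T (c + d) e" "T (c + d) (e + d) = T c (e + d)"
    then have "(w e)\<^sup>2 = w c * w (c + d)" "(w (e + d))\<^sup>2 = w (c + d) * w c"
      using wc trace_eqD[of "w e" "w c" "w (c + d)"] trace_eqD[of "w (e + d)" "w (c + d)" "w c"]
      by (auto simp: T_def add.commute)
    then show False using w_square_inj[of e "e + d"] we by (simp add: mult.commute)
  qed
qed

lemma no_bent_cube: False
  using cube_trichotomy[of n] no_point_case no_line_case no_affine_case by metis

end

section \<open>From spectrum to autocorrelation\<close>

text \<open>Bits provide the addition modulo 2 that directions need, while \<open>Z2_vectors\<close>
  consists of integer representatives; the restricted lambda supplies \<open>undefined\<close>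
  outside the index range.\<close>

definition bvec :: "cube \<Rightarrow> nat \<Rightarrow> int" where
  "bvec = (\<lambda>(x, y, z). \<lambda>i\<in>{..<3}. of_bool ((if i = 0 then x else if i = 1 then y else z) = 1))"

lemma bij_betw_bvec: "bij_betw bvec UNIV (Z2_vectors 3)"
proof (rule bij_betw_byWitness[where f' = "\<lambda>v. (of_int (v 0), of_int (v 1), of_int (v 2))"])
  have carrier: "carrier (residue_ring 2) = {0, 1}"
    by (auto simp: residue_ring_def)
  have less3: "i < 3 \<longleftrightarrow> i = 0 \<or> i = 1 \<or> i = (2::nat)" for i by auto
  show "\<forall>x\<in>UNIV. (of_int (bvec x 0), of_int (bvec x 1), of_int (bvec x 2)) = x"
    by (auto simp: bvec_def)
  show "bvec ` UNIV \<subseteq> Z2_vectors 3"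
    by (auto simp: bvec_def Z2_vectors_def carrier split: if_splits)
  show "\<forall>v\<in>Z2_vectors 3. bvec (of_int (v 0), of_int (v 1), of_int (v 2)) = v"
  proof
    fix v assume v: "v \<in> Z2_vectors 3"
    have v01: "v i = 0 \<or> v i = 1" if "i < 3" for i
      using v that unfolding Z2_vectors_def carrier by (auto dest: PiE_mem)
    have vun: "v i = undefined" if "\<not> i < 3" for i
      using v that unfolding Z2_vectors_def by (auto dest: PiE_arb)
    show "bvec (of_int (v 0), of_int (v 1), of_int (v 2)) = v"
    proof
      fix i show "bvec (of_int (v 0), of_int (v 1), of_int (v 2)) i = v i"
        using v01[of 0] v01[of 1] v01[of 2] vun[of i] less3[of i]
        by (cases "i < 3") (auto simp: bvec_def)
    qed
  qed
qed simp

section \<open>Characters and Fourier inversion on the cube\<close>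

definition cube_char :: "cube \<Rightarrow> cube \<Rightarrow> complex" where
  "cube_char = (\<lambda>(y1, y2, y3) (x1, x2, x3). if y1 * x1 + y2 * x2 + y3 * x3 = 0 then 1 else -1)"

lemma cube_char_inner: "(- 1) powi inner_Z2 3 (bvec y) (bvec x) = cube_char y x"
proof -
  obtain x1 x2 x3 y1 y2 y3 where "x = (x1, x2, x3)" "y = (y1, y2, y3)"
    by (metis prod_cases3)
  then show ?thesis
    by (cases x1; cases x2; cases x3; cases y1; cases y2; cases y3)
      (simp_all add: inner_Z2_def bvec_def cube_char_def numeral_3_eq_3)
qed

lemma cube_char_commute: "cube_char y x = cube_char x y"
  by (cases x; cases y) (simp add: cube_char_def mult.commute)

lemma cube_char_add: "cube_char y (x + x') = cube_char y x * cube_char y x'"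
proof -
  have "(if (a + b :: bit) = 0 then 1 else - 1 :: complex)
    = (if a = 0 then 1 else - 1) * (if b = 0 then 1 else - 1)" for a b
    by (cases a; cases b) simp_all
  from this[symmetric] show ?thesis
    by (cases x; cases y; cases x') (simp only: cube_char_def case_prod_conv add_Pair
        distrib_left ac_simps)
qed

lemma cnj_cube_char [simp]: "cnj (cube_char y x) = cube_char y x"
  by (cases x; cases y) (simp add: cube_char_def)

text \<open>Orthogonality: for nonzero \<open>v\<close>, translation by some \<open>y0\<close> with
  character value -1 negates the sum.\<close>

lemma sum_cube_char:
  "(\<Sum>y\<in>UNIV. cube_char y v) = (if v = 0 then 8 else 0)"
proof (cases "v = 0")
  case True
  have "cube_char y 0 = 1" for y by (cases y) (simp add: cube_char_def zero_prod_def)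
  then show ?thesis using True card_cube by simp
next
  case False
  obtain v1 v2 v3 where v: "v = (v1, v2, v3)" by (metis prod_cases3)
  have "\<exists>y. cube_char y v = -1"
  proof -
    have "cube_char (1,0,0) v = -1 \<or> cube_char (0,1,0) v = -1 \<or> cube_char (0,0,1) v = -1"
      using False by (auto simp: v cube_char_def zero_prod_def)
    then show ?thesis by blast
  qed
  then obtain y0 where y0: "cube_char y0 v = -1" by blast
  have "(\<Sum>y\<in>UNIV. cube_char y v) = (\<Sum>y\<in>UNIV. cube_char (y0 + y) v)"
    by (rule cube_sum_translate[symmetric])
  also have "\<dots> = - (\<Sum>y\<in>UNIV. cube_char y v)"
    using y0 by (simp add: cube_char_commute[of _ v] cube_char_add sum_negf)
  finally show ?thesis using False by simp
qed

text \<open>Up to a factor, the autocorrelation is the inverse Fourier transform of the squared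
  modulus of the spectrum, and a constant transforms to a multiple of the delta function at
  0.\<close>

lemma flat_spectrum_autocorrelation:
  assumes flat: "\<And>y. (cmod (\<Sum>x\<in>UNIV. a x * cube_char y x))\<^sup>2 = N" and s: "s \<noteq> 0"
  shows "(\<Sum>x\<in>UNIV. a x * cnj (a (x + s))) = 0"
proof -
  define F where "F y = (\<Sum>x\<in>UNIV. a x * cube_char y x)" for y
  have "0 = of_real N * (\<Sum>y\<in>UNIV. cube_char y s)"
    using s by (simp add: sum_cube_char)
  also have "\<dots> = (\<Sum>y\<in>UNIV. F y * cnj (F y) * cube_char y s)"
    unfolding complex_norm_square[symmetric] F_def flat by (rule sum_distrib_left)
  also have "\<dots> = (\<Sum>y\<in>UNIV. \<Sum>x\<in>UNIV. \<Sum>x'\<in>UNIV. a x * cnj (a x') * cube_char y (x + x' + s))"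
    unfolding F_def cnj_sum sum_product unfolding sum_distrib_right
    by (simp add: cube_char_add ac_simps)
  also have "\<dots> = (\<Sum>x\<in>UNIV. \<Sum>y\<in>UNIV. \<Sum>x'\<in>UNIV. a x * cnj (a x') * cube_char y (x + x' + s))"
    by (rule sum.swap)
  also have "\<dots> = (\<Sum>x\<in>UNIV. \<Sum>x'\<in>UNIV. \<Sum>y\<in>UNIV. a x * cnj (a x') * cube_char y (x + x' + s))"
    by (intro sum.cong refl sum.swap)
  also have "\<dots> = (\<Sum>x\<in>UNIV. \<Sum>x'\<in>UNIV. if x' = x + s then a x * cnj (a x') * 8 else 0)"
  proof (intro sum.cong refl)
    fix x x' :: cube
    have "x + x' + s = 0 \<longleftrightarrow> x + x' = s"
      using cube_sum_eq_iff[of "x + x'" s 0] by simp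
    also have "\<dots> \<longleftrightarrow> x' = x + s" by auto
    finally have "x + x' + s = 0 \<longleftrightarrow> x' = x + s" .
    then show "(\<Sum>y\<in>UNIV. a x * cnj (a x') * cube_char y (x + x' + s))
        = (if x' = x + s then a x * cnj (a x') * 8 else 0)"
      by (simp add: sum_distrib_left[symmetric] sum_cube_char)
  qed
  also have "\<dots> = 8 * (\<Sum>x\<in>UNIV. a x * cnj (a (x + s)))"
    by (simp add: sum_distrib_left mult.commute)
  finally show ?thesis by simp
qed

lemma zeta_power:
  assumes "m > 0" shows "zeta m ^ nat m = 1"
proof -
  have "zeta m ^ nat m = exp (of_nat (nat m) * (2 * of_real pi * \<i> / of_int m))"
    unfolding zeta_def by (rule exp_of_nat_mult[symmetric])
  also have "of_nat (nat m) * (2 * of_real pi * \<i> / of_int m) = (2 * of_real pi * \<i> :: complex)"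
    using assms by (simp add: of_nat_nat)
  finally show ?thesis by simp
qed

theorem theorem4p4:
  fixes m :: int
  assumes "m \<ge> 2" and "odd m \<or> [m = 2] (mod 4)"
  shows "\<not> (\<exists>f. generalized_bent m 3 f)"
proof
  assume "\<exists>f. generalized_bent m 3 f"
  then obtain f where f: "\<And>y. y \<in> Z2_vectors 3 \<Longrightarrow> (cmod (gbf_transform m 3 f y))\<^sup>2 = 2 ^ 3"
    unfolding generalized_bent_def by blast
  define a where "a x = zeta m powi f (bvec x)" for x
  \<comment> \<open>The witness is \<open>nat m\<close> for odd \<open>m\<close> and
    \<open>nat (m div 2)\<close> otherwise.\<close>
  have "\<exists>k. odd k \<and> nat m dvd 2 * k"
  proof (cases "odd m")
    case True
    then show ?thesis using assms(1) by (intro exI[of _ "nat m"]) (simp add: even_nat_iff)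
  next
    case False
    then have "m mod 4 = 2" using assms(2) by (simp add: cong_def)
    then have "odd (m div 2)" "m = 2 * (m div 2)" by presburger+
    then have "odd (nat (m div 2))" "nat m = 2 * nat (m div 2)"
      using assms(1) by (auto simp: even_nat_iff)
    then show ?thesis by (metis dvd_refl)
  qed
  then obtain k where k: "odd k" "nat m dvd 2 * k" by blast
  interpret bent_cube a k
  proof
    fix x
    have "zeta m ^ (2 * k) = 1"
      using k(2) zeta_power[of m] assms(1) by (metis dvdE power_mult power_one zero_less_numeral
          less_le_trans)
    moreover have "a x ^ (2 * k) = (zeta m ^ (2 * k)) powi f (bvec x)"
      unfolding a_def by (simp only: power_int_power power_int_power' mult.commute)
    ultimately show "a x ^ (2 * k) = 1" by simp
  next
    fix s :: cube assume "s \<noteq> 0"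
    moreover have "(cmod (\<Sum>x\<in>UNIV. a x * cube_char y x))\<^sup>2 = 8" for y
    proof -
      have "gbf_transform m 3 f (bvec y) = (\<Sum>x\<in>UNIV. a x * cube_char y x)"
        unfolding gbf_transform_def sum.reindex_bij_betw[OF bij_betw_bvec, symmetric]
            cube_char_inner a_def ..
      moreover have "bvec y \<in> Z2_vectors 3" using bij_betw_bvec by (auto simp: bij_betw_def)
      ultimately show ?thesis using f by fastforce
    qed
    ultimately show "(\<Sum>x\<in>UNIV. a x * cnj (a (x + s))) = 0"
      by (intro flat_spectrum_autocorrelation)
  qed (use k in simp)
  show False by (rule no_bent_cube)
qed

end
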